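(* Let $p$ and $q$ be distinct primes with $pq\neq 6$, $q\neq 2$ and $q\mid p-1$. Let $r$ be an integer with $r^{q}\equiv 1 \pmod{p}$ and $r\not\equiv 1\pmod{p}$, and let $G=\langle a,b,c\mid a^{q^{2}}=b^{p}=c^{p}=[a,b]=[b,c]=1,\ a^{-1}ca=c^{r}\rangle$. Then $\mathrm{Aut}(G)\simeq\mathbb{Z}_{p}\rtimes((\mathbb{Z}_{p-1}\times\mathbb{Z}_{p-1})\times\mathbb{Z}_{q})$.
   Context: $\mathbb{Z}_n$ is the cyclic group of order $n$; $[x,y]=x^{-1}y^{-1}xy$. $X\rtimes Y$ denotes a semidirect product with normal subgroup $X$ with respect to some homomorphism $Y\to\mathrm{Aut}(X)$; the statement asserts that $\mathrm{Aut}(G)$ is isomorphic to such a semidirect product for some choice of action. *)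

theory Defs
  imports "HOL-Algebra.Bij" "HOL-Algebra.Elementary_Groups" "HOL-Number_Theory.Cong"
begin

section \<open>Free groups\<close>

text \<open>A letter \<open>(g, True)\<close> stands for the generator \<open>g\<close> and \<open>(g, False)\<close> for its inverse.
  The free group on the type \<open>'g\<close> consists of all words modulo free cancellation.\<close>

type_synonym 'g word = "('g \<times> bool) list"

inductive word_eq :: "'g word \<Rightarrow> 'g word \<Rightarrow> bool" where
  refl: "word_eq u u"
| sym: "word_eq u v \<Longrightarrow> word_eq v u"
| trans: "word_eq u v \<Longrightarrow> word_eq v w \<Longrightarrow> word_eq u w"
| cancel: "word_eq (u @ [(g, e), (g, \<not> e)] @ v) (u @ v)"

definition word_class :: "'g word \<Rightarrow> 'g word set" where
  "word_class u = {v. word_eq u v}"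

definition free_group :: "'g word set monoid" where
  "free_group = \<lparr>carrier = range word_class,
     monoid.mult = (\<lambda>X Y. \<Union>u\<in>X. \<Union>v\<in>Y. word_class (u @ v)),
     one = word_class []\<rparr>"

definition free_gen :: "'g \<Rightarrow> 'g word set" where
  "free_gen g = word_class [(g, True)]"

lemma word_class_eq_iff: "word_class u = word_class v \<longleftrightarrow> word_eq u v"
proof
  assume "word_class u = word_class v"
  moreover have "v \<in> word_class v" by (simp add: word_class_def word_eq.refl)
  ultimately have "v \<in> word_class u" by simp
  then show "word_eq u v" by (simp add: word_class_def)
next
  assume uv: "word_eq u v"
  show "word_class u = word_class v"
    unfolding word_class_def
    using word_eq.trans[OF uv] word_eq.trans[OF word_eq.sym[OF uv]] by blast
qed

lemma word_eq_append_left: "word_eq u v \<Longrightarrow> word_eq (w @ u) (w @ v)"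
proof (induction rule: word_eq.induct)
  case (refl u)
  show ?case by (rule word_eq.refl)
next
  case (sym u v)
  show ?case by (rule word_eq.sym) (rule sym.IH)
next
  case (trans u v x)
  show ?case by (rule word_eq.trans) (rule trans.IH)+
next
  case (cancel u g e v)
  show ?case using word_eq.cancel[of "w @ u" g e v] by simp
qed

lemma word_eq_append_right: "word_eq u v \<Longrightarrow> word_eq (u @ w) (v @ w)"
proof (induction rule: word_eq.induct)
  case (refl u)
  show ?case by (rule word_eq.refl)
next
  case (sym u v)
  show ?case by (rule word_eq.sym) (rule sym.IH)
next
  case (trans u v x)
  show ?case by (rule word_eq.trans) (rule trans.IH)+
next
  case (cancel u g e v)
  show ?case using word_eq.cancel[of u g e "v @ w"] by simp
qed

lemma word_eq_append: "word_eq u u' \<Longrightarrow> word_eq v v' \<Longrightarrow> word_eq (u @ v) (u' @ v')"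
  by (rule word_eq.trans[OF word_eq_append_left word_eq_append_right])

lemma free_group_carrier: "carrier free_group = range word_class"
  by (simp add: free_group_def)

lemma free_group_one: "\<one>\<^bsub>free_group\<^esub> = word_class []"
  by (simp add: free_group_def)

lemma free_group_mult:
  "word_class u \<otimes>\<^bsub>free_group\<^esub> word_class v = word_class (u @ v)"
proof -
  have "word_class (u' @ v') = word_class (u @ v)"
    if "u' \<in> word_class u" "v' \<in> word_class v" for u' v'
    using that unfolding word_class_eq_iff
    by (simp add: word_class_def word_eq_append word_eq.sym)
  moreover have "u \<in> word_class u" "v \<in> word_class v"
    by (auto simp: word_class_def intro: word_eq.refl)
  ultimately have "(\<Union>u'\<in>word_class u. \<Union>v'\<in>word_class v. word_class (u' @ v')) = word_class (u @ v)"
    by blast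
  then show ?thesis by (simp add: free_group_def)
qed

definition word_inv :: "'g word \<Rightarrow> 'g word" where
  "word_inv u = rev (map (\<lambda>(g, e). (g, \<not> e)) u)"

lemma word_eq_inv_left: "word_eq (word_inv u @ u) []"
proof (induction u)
  case Nil
  show ?case by (simp add: word_inv_def word_eq.refl)
next
  case (Cons x u)
  obtain g e where x: "x = (g, e)" by force
  have "word_eq (word_inv (x # u) @ x # u) (word_inv u @ u)"
    using word_eq.cancel[of "word_inv u" g "\<not> e" u] by (simp add: word_inv_def x)
  then show ?case by (rule word_eq.trans) (rule Cons.IH)
qed

lemma group_free_group: "group free_group"
proof (rule groupI)
  fix X :: "'g word set" assume "X \<in> carrier free_group"
  then obtain u where "X = word_class u" by (auto simp: free_group_carrier)
  then show "\<exists>Y\<in>carrier free_group. Y \<otimes>\<^bsub>free_group\<^esub> X = \<one>\<^bsub>free_group\<^esub>"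
    by (auto simp: free_group_carrier free_group_one free_group_mult word_class_eq_iff
        intro: word_eq_inv_left)
qed (auto simp: free_group_carrier free_group_one free_group_mult)

lemma free_gen_closed: "free_gen g \<in> carrier free_group"
  by (simp add: free_gen_def free_group_carrier)


section \<open>Groups given by generators and relators\<close>

definition normal_closure :: "('a, 'b) monoid_scheme \<Rightarrow> 'a set \<Rightarrow> 'a set" where
  "normal_closure G S = \<Inter>{N. N \<lhd> G \<and> S \<subseteq> N}"

definition presented_group :: "'g word set set \<Rightarrow> 'g word set set monoid" where
  "presented_group R = free_group Mod normal_closure free_group R"

lemma (in group) normal_normal_closure:
  assumes "S \<subseteq> carrier G"
  shows "normal_closure G S \<lhd> G"
proof -
  have G: "carrier G \<lhd> G"
    by (simp add: normal_inv_iff subgroup_self)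
  have "subgroup (normal_closure G S) G"
    unfolding normal_closure_def
    by (rule subgroups_Inter) (use G assms in \<open>auto simp: normal_inv_iff\<close>)
  then show ?thesis
    by (simp add: normal_inv_iff) (simp add: normal_closure_def normal_inv_iff)
qed

lemma group_presented_group:
  "R \<subseteq> carrier free_group \<Longrightarrow> group (presented_group R)"
  unfolding presented_group_def
  by (intro normal.factorgroup_is_group group.normal_normal_closure group_free_group)


section \<open>The group under consideration\<close>

definition commutator :: "('a, 'b) monoid_scheme \<Rightarrow> 'a \<Rightarrow> 'a \<Rightarrow> 'a" where
  "commutator G x y = inv\<^bsub>G\<^esub> x \<otimes>\<^bsub>G\<^esub> inv\<^bsub>G\<^esub> y \<otimes>\<^bsub>G\<^esub> x \<otimes>\<^bsub>G\<^esub> y"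

datatype gen = gen_a | gen_b | gen_c

text \<open>The relation \<open>a\<^sup>-\<^sup>1ca = c\<^sup>r\<close> is encoded by the relator \<open>a\<^sup>-\<^sup>1ca(c\<^sup>r)\<^sup>-\<^sup>1\<close>.\<close>

definition relators :: "nat \<Rightarrow> nat \<Rightarrow> int \<Rightarrow> gen word set set" where
  "relators p q r =
    (let F = free_group; a = free_gen gen_a; b = free_gen gen_b; c = free_gen gen_c in
      {a [^]\<^bsub>F\<^esub> (q ^ 2), b [^]\<^bsub>F\<^esub> p, c [^]\<^bsub>F\<^esub> p, commutator F a b, commutator F b c,
       (inv\<^bsub>F\<^esub> a \<otimes>\<^bsub>F\<^esub> c \<otimes>\<^bsub>F\<^esub> a) \<otimes>\<^bsub>F\<^esub> inv\<^bsub>F\<^esub> (c [^]\<^bsub>F\<^esub> r)})"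

definition group_pqr :: "nat \<Rightarrow> nat \<Rightarrow> int \<Rightarrow> gen word set set monoid" where
  "group_pqr p q r = presented_group (relators p q r)"

lemma relators_closed: "relators p q r \<subseteq> carrier free_group"
proof -
  interpret group "free_group :: gen word set monoid" by (rule group_free_group)
  show ?thesis by (simp add: relators_def Let_def commutator_def free_gen_closed)
qed

lemma group_group_pqr: "group (group_pqr p q r)"
  unfolding group_pqr_def by (rule group_presented_group[OF relators_closed])


section \<open>Semidirect products\<close>

text \<open>The action is \<open>\<phi> \<in> hom Y (AutoGroup X)\<close>, and \<open>X\<close> is the normal factor.\<close>

definition semidirect_product ::
  "('a, 'm) monoid_scheme \<Rightarrow> ('b, 'n) monoid_scheme \<Rightarrow> ('b \<Rightarrow> 'a \<Rightarrow> 'a) \<Rightarrow> ('a \<times> 'b) monoid" where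
  "semidirect_product X Y \<phi> = \<lparr>carrier = carrier X \<times> carrier Y,
     monoid.mult = (\<lambda>(x, y) (x', y'). (x \<otimes>\<^bsub>X\<^esub> \<phi> y x', y \<otimes>\<^bsub>Y\<^esub> y')),
     one = (\<one>\<^bsub>X\<^esub>, \<one>\<^bsub>Y\<^esub>)\<rparr>"

lemma group_semidirect_product:
  assumes "group X" "group Y" and \<phi>: "\<phi> \<in> hom Y (AutoGroup X)"
  shows "group (semidirect_product X Y \<phi>)"
proof -
  interpret X: group X by fact
  interpret Y: group Y by fact
  interpret A: group "AutoGroup X" by (rule X.AutoGroup)
  interpret \<phi>: group_hom Y "AutoGroup X" \<phi>
    by unfold_locales (rule \<phi>)
  have auto: "\<phi> y \<in> auto X" if "y \<in> carrier Y" for y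
    using \<phi>.hom_closed[OF that] by (simp add: AutoGroup_def)
  have closed: "\<phi> y x \<in> carrier X" if "y \<in> carrier Y" "x \<in> carrier X" for x y
    using auto[OF that(1)] that(2) by (auto simp: auto_def hom_def)
  have mult: "\<phi> y (x \<otimes>\<^bsub>X\<^esub> x') = \<phi> y x \<otimes>\<^bsub>X\<^esub> \<phi> y x'"
    if "y \<in> carrier Y" "x \<in> carrier X" "x' \<in> carrier X" for x x' y
    using auto[OF that(1)] that by (auto simp: auto_def hom_def)
  have comp: "\<phi> (y \<otimes>\<^bsub>Y\<^esub> y') x = \<phi> y (\<phi> y' x)"
    if "y \<in> carrier Y" "y' \<in> carrier Y" "x \<in> carrier X" for x y y'
    using \<phi>.hom_mult[OF that(1,2)] auto[OF that(1)] auto[OF that(2)] that(3)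
    by (simp add: AutoGroup_def BijGroup_def auto_def compose_def)
  have one: "\<phi> \<one>\<^bsub>Y\<^esub> x = x" if "x \<in> carrier X" for x
    using \<phi>.hom_one that by (simp add: AutoGroup_def BijGroup_def)
  show ?thesis
  proof (rule groupI)
    fix z assume "z \<in> carrier (semidirect_product X Y \<phi>)"
    then obtain x y where z: "z = (x, y)" and xy: "x \<in> carrier X" "y \<in> carrier Y"
      by (auto simp: semidirect_product_def)
    let ?y = "inv\<^bsub>Y\<^esub> y"
    let ?w = "(inv\<^bsub>X\<^esub> (\<phi> ?y x), ?y)"
    have "?w \<in> carrier (semidirect_product X Y \<phi>)"
      using xy by (simp add: semidirect_product_def closed del: \<phi>.hom_inv)
    moreover have "?w \<otimes>\<^bsub>semidirect_product X Y \<phi>\<^esub> z = \<one>\<^bsub>semidirect_product X Y \<phi>\<^esub>"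
      using xy by (simp add: semidirect_product_def z closed del: \<phi>.hom_inv)
    ultimately show "\<exists>w\<in>carrier (semidirect_product X Y \<phi>).
        w \<otimes>\<^bsub>semidirect_product X Y \<phi>\<^esub> z = \<one>\<^bsub>semidirect_product X Y \<phi>\<^esub>"
      by blast
  qed (auto simp: semidirect_product_def closed mult comp one X.m_assoc Y.m_assoc
      simp del: \<phi>.hom_mult \<phi>.hom_one)
qed

end

theory Submission
  imports Defs "HOL-Number_Theory.Residue_Primitive_Roots"
begin

text \<open>
  Let \<open>s\<close> be the residue of \<open>r\<close> modulo \<open>p\<close>; it has multiplicative order exactly \<open>q\<close>. Every element of
  \<open>G\<close> has a normal form \<open>a\<^sup>i b\<^sup>j c\<^sup>k\<close>, unique with \<open>i\<close> modulo \<open>q\<^sup>2\<close> and \<open>j\<close>, \<open>k\<close> modulo \<open>p\<close>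
  (\<open>group_pqr_pqr_group\<close>): existence follows by moving \<open>a\<close> to the left through \<open>c a = a c\<^sup>s\<close>,
  uniqueness by mapping \<open>G\<close> to three concrete groups that satisfy the relations.

  Comparing normal forms in the images of the defining relations shows that an automorphism has the shape
  \<open>a \<mapsto> a\<^sup>i c\<^sup>y\<close>, \<open>b \<mapsto> b\<^sup>m\<close>, \<open>c \<mapsto> c\<^sup>n\<close> with \<open>i\<close> congruent to 1 modulo \<open>q\<close> and with
  \<open>m\<close>, \<open>n\<close> prime to \<open>p\<close> (\<open>auto_is_endo\<close>). Indeed \<open>f a\<close> must act on \<open>f c\<close> by the \<open>s\<close>-th power,
  so \<open>s\<^sup>i = s\<close> modulo \<open>p\<close>.

  Conversely, all these images satisfy the relations, because \<open>(a\<^sup>i c\<^sup>y)\<^sup>q = a\<^bsup>i q\<^esup>\<close>: the exponent of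
  \<open>c\<close> picks up the factor \<open>1 + s + \<dots> + s\<^sup>q\<^sup>-\<^sup>1\<close>, which vanishes modulo \<open>p\<close> (\<open>twisted_pow_q\<close>). As
  this power is central, two such endomorphisms compose by multiplying \<open>i\<close>, \<open>m\<close> and \<open>n\<close> separately
  and by \<open>(y, n) (y', n') = (y + n y', n n')\<close> (\<open>endo_compose\<close>). Thus \<open>y\<close> ranges over a normal
  \<open>\<int>\<^sub>p\<close> on which only \<open>n\<close> acts, \<open>m\<close> and \<open>n\<close> are powers of a primitive root modulo \<open>p\<close>, and \<open>i = 1 + q w\<close>
  modulo \<open>q\<^sup>2\<close> depends additively on \<open>w \<in> \<int>\<^sub>q\<close>
  (\<open>auto_group_iso_semidirect_product\<close>).
\<close>

section \<open>Homomorphisms out of presented groups\<close>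

fun word_eval :: "('a, 'm) monoid_scheme \<Rightarrow> ('g \<Rightarrow> 'a) \<Rightarrow> 'g word \<Rightarrow> 'a" where
  "word_eval H f [] = \<one>\<^bsub>H\<^esub>"
| "word_eval H f ((g, e) # u) = (if e then f g else inv\<^bsub>H\<^esub> f g) \<otimes>\<^bsub>H\<^esub> word_eval H f u"

context group
begin

lemma word_eval_closed:
  assumes "range f \<subseteq> carrier G"
  shows "word_eval G f u \<in> carrier G"
proof (induction u)
  case (Cons x u)
  have "f (fst x) \<in> carrier G"
    using assms by auto
  with Cons show ?case
    by (cases x) simp
qed simp

lemma word_eval_append:
  assumes "range f \<subseteq> carrier G"
  shows "word_eval G f (u @ v) = word_eval G f u \<otimes> word_eval G f v"
proof (induction u)
  case (Cons x u)
  have "f (fst x) \<in> carrier G"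
    using assms by auto
  with Cons show ?case
    by (cases x) (simp add: m_assoc word_eval_closed[OF assms])
qed (simp add: word_eval_closed[OF assms])

lemma word_eval_cong:
  assumes f: "range f \<subseteq> carrier G" and "word_eq u v"
  shows "word_eval G f u = word_eval G f v"
  using assms(2)
proof (induction rule: word_eq.induct)
  case (cancel u g e v)
  have "f g \<in> carrier G"
    using f by auto
  then have "word_eval G f [(g, e), (g, \<not> e)] = \<one>"
    by simp
  then show ?case
    by (simp only: word_eval_append[OF f] word_eval_closed[OF f] l_one)
qed auto

lemma free_group_universal:
  assumes f: "range f \<subseteq> carrier G"
  obtains h where "h \<in> hom free_group G" "\<And>g. h (free_gen g) = f g"
proof
  \<comment> \<open>By \<open>word_eval_cong\<close> the chosen representative does not matter.\<close>
  define h where "h X = word_eval G f (SOME u. X = word_class u)" for X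
  have h: "h (word_class u) = word_eval G f u" for u
  proof -
    have "word_class u = word_class (SOME v. word_class u = word_class v)"
      by (rule someI) (rule HOL.refl)
    then show ?thesis
      by (simp add: h_def word_class_eq_iff word_eval_cong[OF f])
  qed
  show "h \<in> hom free_group G"
    by (rule homI)
      (auto simp: free_group_carrier free_group_mult h word_eval_closed[OF f] word_eval_append[OF f])
  show "h (free_gen g) = f g" for g
  proof -
    have "f g \<in> carrier G"
      using f by auto
    then show ?thesis
      by (simp add: free_gen_def h)
  qed
qed

lemma presented_group_universal:
  assumes R: "R \<subseteq> carrier free_group" and h: "h \<in> hom free_group G"
    and one: "\<And>x. x \<in> R \<Longrightarrow> h x = \<one>"
  obtains k where "k \<in> hom (presented_group R) G"
    "\<And>x. x \<in> carrier free_group \<Longrightarrow> k (normal_closure free_group R #>\<^bsub>free_group\<^esub> x) = h x"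
proof -
  interpret F: group free_group by (rule group_free_group)
  interpret h: group_hom free_group G h
    by unfold_locales (rule h)
  have "R \<subseteq> kernel free_group G h"
    using R one by (auto simp: kernel_def)
  then have "normal_closure free_group R \<subseteq> kernel free_group G h"
    unfolding normal_closure_def using h.normal_kernel by blast
  then show thesis
    using that h.FactGroup_universal_kernel[OF F.normal_normal_closure[OF R]]
    unfolding presented_group_def by blast
qed

lemma nat_pow_cong:
  assumes x: "x \<in> carrier G" "x [^] n = \<one>" and "[i = j] (mod n)"
  shows "x [^] (i::nat) = x [^] (j::nat)"
proof -
  have "x [^] i = x [^] (i mod n)" for i :: nat
  proof -
    have "x [^] i = x [^] (n * (i div n) + i mod n)"
      by simp
    also have "\<dots> = (x [^] n) [^] (i div n) \<otimes> x [^] (i mod n)"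
      using x(1) by (simp only: nat_pow_mult nat_pow_pow)
    finally show ?thesis
      using x by simp
  qed
  then show ?thesis
    using assms(3) unfolding cong_def by metis
qed

lemma int_pow_eq_nat_pow:
  assumes x: "x \<in> carrier G" "x [^] n = \<one>" and "[int s = r] (mod int n)"
  shows "x [^] r = x [^] s"
proof -
  obtain t where t: "r = int s + int n * t"
    using assms(3) by (auto simp: cong_iff_lin)
  have "x [^] (int n * t) = (x [^] n) [^] t"
    using x(1) by (simp add: int_pow_pow flip: int_pow_int)
  then show ?thesis
    using x by (simp add: t int_pow_int int_pow_mult)
qed

lemma commutator_eq_one_iff:
  assumes "x \<in> carrier G" "y \<in> carrier G"
  shows "commutator G x y = \<one> \<longleftrightarrow> x \<otimes> y = y \<otimes> x"
proof -
  have "commutator G x y = inv (y \<otimes> x) \<otimes> (x \<otimes> y)"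
    using assms by (simp add: commutator_def inv_mult_group m_assoc)
  then show ?thesis
    using assms by (metis inv_closed inv_equality inv_inv l_inv m_closed)
qed

lemma conjugation_relator_eq_one_iff:
  assumes "x \<in> carrier G" "y \<in> carrier G" "z \<in> carrier G"
  shows "(inv x \<otimes> y \<otimes> x) \<otimes> inv z = \<one> \<longleftrightarrow> y \<otimes> x = x \<otimes> z"
proof -
  have "(inv x \<otimes> y \<otimes> x) \<otimes> inv z = \<one> \<longleftrightarrow> inv x \<otimes> (y \<otimes> x) = z"
    using assms by (metis inv_closed inv_equality inv_inv m_assoc m_closed r_inv)
  also have "\<dots> \<longleftrightarrow> y \<otimes> x = x \<otimes> z"
    using assms by (metis inv_closed inv_solve_left m_closed)
  finally show ?thesis .
qed

end

section \<open>The defining relations\<close>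

text \<open>The integer exponent \<open>r\<close> is replaced by a natural number \<open>s\<close> congruent to it, so that all
  later exponent arithmetic takes place in the natural numbers. The relation for \<open>s\<close> is equivalent
  to the one for \<open>r\<close> because \<open>c\<^sup>p = 1\<close>.\<close>

definition satisfies_relations ::
  "('a, 'm) monoid_scheme \<Rightarrow> nat \<Rightarrow> nat \<Rightarrow> nat \<Rightarrow> 'a \<Rightarrow> 'a \<Rightarrow> 'a \<Rightarrow> bool" where
  "satisfies_relations G p q s a b c \<longleftrightarrow>
     a \<in> carrier G \<and> b \<in> carrier G \<and> c \<in> carrier G \<and>
     a [^]\<^bsub>G\<^esub> (q ^ 2) = \<one>\<^bsub>G\<^esub> \<and> b [^]\<^bsub>G\<^esub> p = \<one>\<^bsub>G\<^esub> \<and> c [^]\<^bsub>G\<^esub> p = \<one>\<^bsub>G\<^esub> \<and>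
     a \<otimes>\<^bsub>G\<^esub> b = b \<otimes>\<^bsub>G\<^esub> a \<and> b \<otimes>\<^bsub>G\<^esub> c = c \<otimes>\<^bsub>G\<^esub> b \<and> c \<otimes>\<^bsub>G\<^esub> a = a \<otimes>\<^bsub>G\<^esub> c [^]\<^bsub>G\<^esub> s"

text \<open>Used in both directions: for the projection onto the presented group it yields the relations
  there, and for a homomorphism given by the values on the generators it yields the factorization
  through the presented group.\<close>

lemma (in group) relators_trivial_iff:
  assumes h: "h \<in> hom free_group G" and s: "[int s = r] (mod int p)"
  shows "(\<forall>x\<in>relators p q r. h x = \<one>) \<longleftrightarrow>
    satisfies_relations G p q s (h (free_gen gen_a)) (h (free_gen gen_b)) (h (free_gen gen_c))"
proof -
  interpret F: group "free_group :: gen word set monoid" by (rule group_free_group)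
  interpret h: group_hom free_group G h
    by unfold_locales (rule h)
  let ?h = "\<lambda>g. h (free_gen g)"
  have closed: "?h g \<in> carrier G" for g
    by (simp add: free_gen_closed)
  have comm: "h (commutator free_group (free_gen x) (free_gen y)) = commutator G (?h x) (?h y)" for x y
    by (simp add: commutator_def free_gen_closed)
  have "(\<forall>x\<in>relators p q r. h x = \<one>) \<longleftrightarrow>
      ?h gen_a [^] (q ^ 2) = \<one> \<and> ?h gen_b [^] p = \<one> \<and> ?h gen_c [^] p = \<one> \<and>
      commutator G (?h gen_a) (?h gen_b) = \<one> \<and> commutator G (?h gen_b) (?h gen_c) = \<one> \<and>
      (inv ?h gen_a \<otimes> ?h gen_c \<otimes> ?h gen_a) \<otimes> inv (?h gen_c [^] r) = \<one>"
    by (simp add: relators_def Let_def comm h.hom_nat_pow h.hom_int_pow free_gen_closed)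
  also have "\<dots> \<longleftrightarrow> satisfies_relations G p q s (?h gen_a) (?h gen_b) (?h gen_c)"
    unfolding satisfies_relations_def
    using closed int_pow_eq_nat_pow[OF closed _ s]
    by (auto simp: commutator_eq_one_iff conjugation_relator_eq_one_iff)
  finally show ?thesis .
qed

locale relations_group = group G for G (structure) +
  fixes p q s :: nat and a b c
  assumes relations: "satisfies_relations G p q s a b c"
    and p_pos: "p > 0" and q_pos: "q > 0"
begin

lemma gen_closed [simp]: "a \<in> carrier G" "b \<in> carrier G" "c \<in> carrier G"
  and a_pow: "a [^] (q ^ 2) = \<one>" and b_pow: "b [^] p = \<one>" and c_pow: "c [^] p = \<one>"
  and ab: "a \<otimes> b = b \<otimes> a" and bc: "b \<otimes> c = c \<otimes> b" and ca: "c \<otimes> a = a \<otimes> c [^] s"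
  using relations by (auto simp: satisfies_relations_def)

definition nf :: "nat \<Rightarrow> nat \<Rightarrow> nat \<Rightarrow> 'a" where
  "nf i j k = a [^] i \<otimes> b [^] j \<otimes> c [^] k"

lemma nf_closed [simp]: "nf i j k \<in> carrier G"
  by (simp add: nf_def)

lemma commute_pow:
  assumes "x \<otimes> y = y \<otimes> x" "x \<in> carrier G" "y \<in> carrier G"
  shows "x [^] (m::nat) \<otimes> y [^] (n::nat) = y [^] n \<otimes> x [^] m"
proof -
  have *: "u \<otimes> v [^] (n::nat) = v [^] n \<otimes> u"
    if "u \<otimes> v = v \<otimes> u" "u \<in> carrier G" "v \<in> carrier G" for u v n
  proof (induction n)
    case (Suc n)
    then show ?case
      using that by (simp add: m_assoc[symmetric]) (simp add: m_assoc)
  qed (use that in auto)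
  show ?thesis
    using *[of "x [^] m" y n] *[of y x m] assms by simp
qed

lemma c_pow_a_pow: "c [^] k \<otimes> a [^] i = a [^] i \<otimes> c [^] (k * s ^ i)" for k i :: nat
proof (induction i)
  case 0
  then show ?case by simp
next
  case (Suc i)
  have step: "c [^] k \<otimes> a = a \<otimes> c [^] (k * s)" for k :: nat
  proof (induction k)
    case (Suc k)
    have "c [^] Suc k \<otimes> a = c [^] k \<otimes> (c \<otimes> a)"
      by (simp add: m_assoc)
    also have "\<dots> = (c [^] k \<otimes> a) \<otimes> c [^] s"
      by (simp add: ca m_assoc)
    also have "\<dots> = a \<otimes> c [^] (Suc k * s)"
      by (simp add: Suc m_assoc nat_pow_mult add.commute)
    finally show ?case .
  qed simp
  have "c [^] k \<otimes> a [^] Suc i = (c [^] k \<otimes> a [^] i) \<otimes> a"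
    by (simp add: m_assoc)
  also have "\<dots> = a [^] i \<otimes> (c [^] (k * s ^ i) \<otimes> a)"
    by (simp add: Suc m_assoc)
  also have "\<dots> = a [^] Suc i \<otimes> c [^] (k * s ^ Suc i)"
    by (simp add: step m_assoc mult_ac)
  finally show ?case .
qed

text \<open>Moving \<open>a\<^bsup>i'\<^esup>\<close> to the left past \<open>c\<^sup>k\<close> raises \<open>c\<^sup>k\<close> to the power \<open>s\<^bsup>i'\<^esup>\<close>. All further computations
  in the group are reduced to this formula and to congruences between exponents.\<close>

lemma nf_mult: "nf i j k \<otimes> nf i' j' k' = nf (i + i') (j + j') (k * s ^ i' + k')"
proof -
  have "nf i j k \<otimes> nf i' j' k' = a [^] i \<otimes> (b [^] j \<otimes> (c [^] k \<otimes> a [^] i') \<otimes> b [^] j' \<otimes> c [^] k')"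
    by (simp add: nf_def m_assoc)
  also have "\<dots> = a [^] i \<otimes> ((b [^] j \<otimes> a [^] i') \<otimes> (c [^] (k * s ^ i') \<otimes> b [^] j') \<otimes> c [^] k')"
    by (simp add: c_pow_a_pow m_assoc)
  also have "\<dots> = a [^] i \<otimes> ((a [^] i' \<otimes> b [^] j) \<otimes> (b [^] j' \<otimes> c [^] (k * s ^ i')) \<otimes> c [^] k')"
    by (simp add: commute_pow[OF ab] commute_pow[OF bc])
  also have "\<dots> = (a [^] i \<otimes> a [^] i') \<otimes> (b [^] j \<otimes> b [^] j') \<otimes> (c [^] (k * s ^ i') \<otimes> c [^] k')"
    by (simp add: m_assoc)
  finally show ?thesis
    by (simp add: nf_def nat_pow_mult)
qed

lemma nf_cong:
  assumes "[i = i'] (mod q ^ 2)" "[j = j'] (mod p)" "[k = k'] (mod p)"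
  shows "nf i j k = nf i' j' k'"
  using nat_pow_cong[OF _ a_pow assms(1)] nat_pow_cong[OF _ b_pow assms(2)]
    nat_pow_cong[OF _ c_pow assms(3)] by (simp add: nf_def)

lemma nf_zero [simp]: "nf 0 0 0 = \<one>"
  and nf_a: "nf i 0 0 = a [^] i" and nf_b: "nf 0 j 0 = b [^] j" and nf_c: "nf 0 0 k = c [^] k"
  by (simp_all add: nf_def)

lemma nf_pow_ex: "\<exists>k'. nf i j k [^] n = nf (n * i) (n * j) k'"
proof (induction n)
  case (Suc n)
  then show ?case by (auto simp: nf_mult add_ac)
qed (auto intro: exI[of _ 0])

lemma nf_pow: "nf i 0 k [^] n = nf (n * i) 0 (k * (\<Sum>t<n. (s ^ i) ^ t))"
proof (induction n)
  case (Suc n)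
  have "nf i 0 k [^] Suc n = nf i 0 k \<otimes> nf i 0 k [^] n"
    by (rule nat_pow_Suc2) simp
  also have "\<dots> = nf (Suc n * i) 0 (k * (\<Sum>t<Suc n. (s ^ i) ^ t))"
    by (simp add: Suc nf_mult algebra_simps power_mult)
  finally show ?case .
qed simp

lemma inv_gen_eq_pow: "inv a = a [^] (q ^ 2 - 1)" "inv b = b [^] (p - 1)" "inv c = c [^] (p - 1)"
proof -
  have *: "inv x = x [^] (n - 1)" if "x [^] n = \<one>" "n > 0" "x \<in> carrier G" for x and n :: nat
    using that by (intro inv_equality) (cases n, simp_all)
  show "inv a = a [^] (q ^ 2 - 1)" "inv b = b [^] (p - 1)" "inv c = c [^] (p - 1)"
    by (rule *; simp add: a_pow b_pow c_pow p_pos q_pos)+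
qed

text \<open>Inverses of generators are positive powers, so the set of normal forms absorbs every letter
  of a word; by induction on words it exhausts the group.\<close>

lemma nf_closed_under_left_gen:
  assumes "x \<in> {a, b, c, inv a, inv b, inv c}"
  shows "\<exists>i' j' k'. x \<otimes> nf i j k = nf i' j' k'"
proof -
  have "x \<in> {nf 1 0 0, nf 0 1 0, nf 0 0 1, nf (q ^ 2 - 1) 0 0, nf 0 (p - 1) 0, nf 0 0 (p - 1)}"
    using assms by (simp add: nf_a nf_b nf_c inv_gen_eq_pow)
  then obtain i' j' k' where "x = nf i' j' k'"
    by blast
  then show ?thesis
    by (metis nf_mult)
qed

lemma generated_eq_nf:
  assumes h: "h \<in> hom free_group G"
    and abc: "h (free_gen gen_a) = a" "h (free_gen gen_b) = b" "h (free_gen gen_c) = c"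
    and x: "x \<in> carrier free_group"
  shows "\<exists>i j k. h x = nf i j k"
proof -
  interpret F: group "free_group :: gen word set monoid" by (rule group_free_group)
  interpret h: group_hom free_group G h
    by unfold_locales (rule h)
  have "\<exists>i j k. h (word_class u) = nf i j k" for u
  proof (induction u)
    case Nil
    then show ?case
      using h.hom_one nf_zero by (metis free_group_one)
  next
    case (Cons x u)
    obtain g e where x: "x = (g, e)" by force
    have inv: "word_class [(g, False)] = inv\<^bsub>free_group\<^esub> free_gen g"
      using word_eq.cancel[of "[]" g False "[]"]
      by (intro F.inv_equality[symmetric])
        (auto simp: free_gen_def free_group_mult free_group_one word_class_eq_iff free_group_carrier)
    have "h (word_class [x]) \<in> {a, b, c, inv a, inv b, inv c}"
    proof (cases e)
      case True
      then show ?thesis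
        using abc by (cases g) (auto simp: x simp flip: free_gen_def)
    next
      case False
      then have "h (word_class [x]) = inv h (free_gen g)"
        by (simp add: x inv free_gen_closed)
      then show ?thesis
        using abc by (cases g) auto
    qed
    moreover have "h (word_class (x # u)) = h (word_class [x]) \<otimes> h (word_class u)"
      using h.hom_mult[of "word_class [x]" "word_class u"]
      by (simp add: free_group_mult free_group_carrier)
    ultimately show ?case
      using Cons nf_closed_under_left_gen by metis
  qed
  then show ?thesis
    using x by (auto simp: free_group_carrier)
qed

lemma hom_nf:
  assumes "group H" "h \<in> hom G H"
  shows "h (nf i j k) = h a [^]\<^bsub>H\<^esub> i \<otimes>\<^bsub>H\<^esub> h b [^]\<^bsub>H\<^esub> j \<otimes>\<^bsub>H\<^esub> h c [^]\<^bsub>H\<^esub> k"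
proof -
  interpret group_hom G H h
    using assms by (simp add: group_hom_def group_hom_axioms_def group_axioms)
  show ?thesis
    by (simp add: nf_def hom_nat_pow)
qed

end

section \<open>Powers acting on a cyclic group\<close>

definition power_action :: "nat \<Rightarrow> nat \<Rightarrow> int \<Rightarrow> int \<Rightarrow> int" where
  "power_action p g y = (\<lambda>x\<in>carrier (integer_mod_group p). int (g ^ nat y) * x mod int p)"

text \<open>This serves twice: with \<open>n = q\<^sup>2\<close> it gives the concrete semidirect product that shows
  \<open>c \<noteq> 1\<close>, and with a primitive root and \<open>n = p - 1\<close> it gives the action on the normal factor of the
  automorphism group.\<close>

lemma power_action_hom:
  assumes p: "p > 0" and n: "n > 0" and g: "[g ^ n = 1] (mod p)"
  shows "power_action p g \<in> hom (integer_mod_group n) (AutoGroup (integer_mod_group p))"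
proof (rule homI)
  have carrier: "carrier (integer_mod_group m) = {0..<int m}" if "m > 0" for m
    using that by (simp add: carrier_integer_mod_group)
  have "coprime (g ^ n) p"
    using g cong_imp_coprime[OF cong_sym[OF g]] by simp
  then have "coprime g p"
    using n by simp
  then have cop: "coprime (int (g ^ m)) (int p)" for m
    by (simp add: coprime_int_iff)
  have g_mod: "g ^ (m mod n) mod p = g ^ m mod p" for m
  proof -
    have "[g ^ (n * (m div n) + m mod n) = 1 ^ (m div n) * g ^ (m mod n)] (mod p)"
      unfolding power_add power_mult by (intro cong_mult cong_pow g cong_refl)
    then show ?thesis
      by (simp add: cong_def)
  qed
  show auto: "power_action p g y \<in> carrier (AutoGroup (integer_mod_group p))" for y
  proof -
    have "inj_on (power_action p g y) {0..<int p}"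
    proof (rule inj_onI)
      fix x x' assume x: "x \<in> {0..<int p}" "x' \<in> {0..<int p}"
        and "power_action p g y x = power_action p g y x'"
      then have "[int (g ^ nat y) * x = int (g ^ nat y) * x'] (mod int p)"
        using p by (simp add: power_action_def carrier cong_def)
      then have "[x = x'] (mod int p)"
        using cop cong_mult_lcancel by blast
      then show "x = x'"
        using x by (simp add: cong_def)
    qed
    moreover have "power_action p g y ` {0..<int p} \<subseteq> {0..<int p}"
      using p by (auto simp: power_action_def carrier)
    ultimately have "bij_betw (power_action p g y) {0..<int p} {0..<int p}"
      by (simp add: bij_betw_def endo_inj_surj)
    moreover have "power_action p g y \<in> hom (integer_mod_group p) (integer_mod_group p)"
      using p by (intro homI) (auto simp: power_action_def carrier mod_simps algebra_simps)
    ultimately show ?thesis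
      using p by (simp add: AutoGroup_def auto_def Bij_def carrier) (simp add: power_action_def carrier)
  qed
  fix y y' assume y: "y \<in> carrier (integer_mod_group n)" "y' \<in> carrier (integer_mod_group n)"
  have "power_action p g ((y + y') mod int n) =
      compose (carrier (integer_mod_group p)) (power_action p g y) (power_action p g y')"
  proof
    fix x
    have "int (g ^ nat ((y + y') mod int n)) * x mod int p =
        int (g ^ nat y) * (int (g ^ nat y') * x mod int p) mod int p"
    proof -
      have "nat ((y + y') mod int n) = (nat y + nat y') mod n"
        using y n by (simp add: carrier nat_mod_distrib nat_add_distrib)
      then have "int (g ^ nat ((y + y') mod int n)) mod int p = int (g ^ (nat y + nat y')) mod int p"
        using g_mod by (metis zmod_int)
      then have "int (g ^ nat ((y + y') mod int n)) * x mod int p = int (g ^ (nat y + nat y')) * x mod int p"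
        by (metis mod_mult_left_eq)
      then show ?thesis
        by (simp add: power_add mult.assoc mod_simps)
    qed
    then show "power_action p g ((y + y') mod int n) x =
        compose (carrier (integer_mod_group p)) (power_action p g y) (power_action p g y') x"
      using p by (simp add: power_action_def carrier compose_def)
  qed
  then show "power_action p g (y \<otimes>\<^bsub>integer_mod_group n\<^esub> y') =
      power_action p g y \<otimes>\<^bsub>AutoGroup (integer_mod_group p)\<^esub> power_action p g y'"
    using auto[of y] auto[of y'] by (simp add: AutoGroup_def BijGroup_def auto_def)
qed

section \<open>Endomorphisms and automorphisms\<close>

text \<open>The last three assumptions capture the presentation up to isomorphism: the generators suffice,
  no further identities hold between normal forms, and endomorphisms may be prescribed on generators.\<close>

locale pqr_group = relations_group +
  assumes prime_p: "prime p" and prime_q: "prime q" and p_neq_q: "p \<noteq> q"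
    and s_pow_q: "[s ^ q = 1] (mod p)" and s_neq_1: "\<not> [s = 1] (mod p)"
    and nf_exhaust: "x \<in> carrier G \<Longrightarrow> \<exists>i j k. x = nf i j k"
    and nf_eq_one: "nf i j k = \<one> \<Longrightarrow> q ^ 2 dvd i \<and> p dvd j \<and> p dvd k"
    and endomorphism_ex: "satisfies_relations G p q s a' b' c' \<Longrightarrow>
      \<exists>h\<in>hom G G. h a = a' \<and> h b = b' \<and> h c = c'"
begin

lemma coprime_s: "coprime s p"
proof -
  have "coprime (s ^ q) p"
    using cong_imp_coprime[OF cong_sym[OF s_pow_q]] by simp
  then show ?thesis
    using q_pos by simp
qed

text \<open>The order of \<open>s\<close> modulo \<open>p\<close> divides the prime \<open>q\<close> and is not 1, so it is \<open>q\<close>.\<close>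

lemma s_pow_cong: "[i = j] (mod q) \<longleftrightarrow> [s ^ i = s ^ j] (mod p)"
proof -
  have "Pocklington.ord p s dvd q"
    using s_pow_q ord_divides by blast
  moreover have "Pocklington.ord p s \<noteq> 1"
    using s_neq_1 ord_divides[of s 1 p] by auto
  ultimately have "Pocklington.ord p s = q"
    using prime_q by (metis prime_nat_iff)
  then show ?thesis
    using order_divides_expdiff[of p s i j] coprime_s by (simp add: coprime_commute)
qed

lemma s_pow_one: "[i = 1] (mod q) \<Longrightarrow> [s ^ i = s] (mod p)"
  using s_pow_cong[of i 1] by simp

text \<open>Multiplying both sides by the inverse of the first one, itself in normal form, reduces equality to
  the triviality criterion.\<close>

lemma nf_eq_iff:
  "nf i j k = nf i' j' k' \<longleftrightarrow> [i = i'] (mod q ^ 2) \<and> [j = j'] (mod p) \<and> [k = k'] (mod p)"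
proof
  assume eq: "nf i j k = nf i' j' k'"
  obtain i0 j0 k0 where inv: "inv (nf i j k) = nf i0 j0 k0"
    using nf_exhaust[of "inv (nf i j k)"] by auto
  have "nf i j k \<otimes> nf i0 j0 k0 = \<one>" "nf i' j' k' \<otimes> nf i0 j0 k0 = \<one>"
    using inv eq by (metis nf_closed r_inv)+
  then have "[i + i0 = i' + i0] (mod q ^ 2) \<and> [j + j0 = j' + j0] (mod p) \<and>
      [k * s ^ i0 + k0 = k' * s ^ i0 + k0] (mod p)"
    unfolding nf_mult by (auto dest!: nf_eq_one simp: cong_def)
  then show "[i = i'] (mod q ^ 2) \<and> [j = j'] (mod p) \<and> [k = k'] (mod p)"
    using coprime_s by (simp add: cong_add_rcancel_nat cong_mult_rcancel_nat)
qed (use nf_cong in blast)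

lemma s_minus_one_cancel:
  assumes "[s * k = k] (mod p)"
  shows "p dvd k"
proof -
  have "int p dvd (int s - 1) * int k"
    using assms by (simp add: cong_iff_dvd_diff algebra_simps flip: cong_int_iff)
  moreover have "\<not> int p dvd int s - 1"
    using s_neq_1 cong_int_iff[of s 1 p] by (simp add: cong_iff_dvd_diff)
  ultimately show ?thesis
    using prime_p by (simp add: prime_dvd_mult_iff)
qed

text \<open>The sum \<open>x\<close> satisfies \<open>(s - 1) x = s\<^sup>q - 1\<close>, which is 0 modulo \<open>p\<close>.\<close>

lemma geometric_sum_dvd: "p dvd (\<Sum>t<q. s ^ t)"
proof (rule s_minus_one_cancel)
  have "s * (\<Sum>t<q. s ^ t) + 1 = (\<Sum>t<q. s ^ t) + s ^ q"
    using sum.lessThan_Suc_shift[of "\<lambda>t. s ^ t" q] sum.lessThan_Suc[of "\<lambda>t. s ^ t" q]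
    by (simp add: sum_distrib_left)
  moreover have "[(\<Sum>t<q. s ^ t) + s ^ q = (\<Sum>t<q. s ^ t) + 1] (mod p)"
    by (intro cong_add s_pow_q cong_refl)
  ultimately have "[s * (\<Sum>t<q. s ^ t) + 1 = (\<Sum>t<q. s ^ t) + 1] (mod p)"
    by simp
  then show "[s * (\<Sum>t<q. s ^ t) = (\<Sum>t<q. s ^ t)] (mod p)"
    by (simp only: cong_add_rcancel_nat)
qed

text \<open>The twist by \<open>c\<^sup>y\<close> disappears in the \<open>q\<close>-th power: since \<open>s\<^sup>i = s\<close> modulo \<open>p\<close>, the exponent
  of \<open>c\<close> is a multiple of the geometric sum above. The element \<open>a\<^sup>i c\<^sup>y\<close> is in fact a conjugate of
  \<open>a\<^sup>i\<close>, and \<open>a\<^bsup>i q\<^esup>\<close> is central.\<close>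

lemma twisted_pow_q:
  assumes i: "[i = 1] (mod q)"
  shows "nf i 0 y [^] q = a [^] (q * i)"
proof -
  have "[(\<Sum>t<q. (s ^ i) ^ t) = (\<Sum>t<q. s ^ t)] (mod p)"
    by (intro cong_sum cong_pow s_pow_one[OF i])
  then have "p dvd (\<Sum>t<q. (s ^ i) ^ t)"
    using geometric_sum_dvd cong_dvd_iff by blast
  then have "nf (q * i) 0 (y * (\<Sum>t<q. (s ^ i) ^ t)) = nf (q * i) 0 0"
    by (intro nf_cong) (auto simp: cong_0_iff)
  then show ?thesis
    by (simp only: nf_pow nf_a)
qed

text \<open>Only the exponent of \<open>a\<close> is multiplied, because \<open>j - 1\<close> of the factors combine to powers of
  \<open>a\<^bsup>i q\<^esup>\<close>. This is why the \<open>\<int>\<^sub>q\<close> of exponents \<open>i\<close> commutes with the \<open>\<int>\<^sub>p\<close> of exponents \<open>y\<close> in the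
  automorphism group.\<close>

lemma twisted_pow:
  assumes i: "[i = 1] (mod q)" and j: "[j = 1] (mod q)"
  shows "nf i 0 y [^] j = nf (i * j) 0 y"
proof -
  have "j mod q = 1"
    using j prime_gt_1_nat[OF prime_q] by (simp add: cong_def)
  then obtain w where w: "j = 1 + q * w"
    by (metis add.commute mult_div_mod_eq)
  have "nf i 0 y [^] j = nf i 0 y \<otimes> (nf i 0 y [^] q) [^] w"
    using nat_pow_Suc2[OF nf_closed] by (simp add: w nat_pow_pow)
  also have "\<dots> = nf i 0 y \<otimes> nf (q * i * w) 0 0"
    by (simp add: twisted_pow_q[OF i] nat_pow_pow nf_a)
  also have "\<dots> = nf (i + q * i * w) 0 (y * s ^ (q * i * w))"
    by (simp add: nf_mult)
  also have "\<dots> = nf (i * j) 0 y"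
  proof (rule nf_cong)
    have "[s ^ (q * i * w) = s ^ 0] (mod p)"
      unfolding s_pow_cong[symmetric] by (simp add: cong_0_iff)
    then show "[y * s ^ (q * i * w) = y] (mod p)"
      using cong_mult[OF cong_refl, of _ 1 p y] by simp
  qed (simp_all add: w algebra_simps)
  finally show ?thesis .
qed

lemma images_satisfy_relations:
  fixes m n :: nat
  assumes i: "[i = 1] (mod q)"
  shows "satisfies_relations G p q s (nf i 0 y) (b [^] m) (c [^] n)"
proof -
  have "nf i 0 y [^] (q ^ 2) = (nf i 0 y [^] q) [^] q"
    by (simp add: nat_pow_pow power2_eq_square)
  also have "\<dots> = (a [^] (q ^ 2)) [^] i"
    by (simp add: twisted_pow_q[OF i] nat_pow_pow power2_eq_square mult_ac)
  finally have 1: "nf i 0 y [^] (q ^ 2) = \<one>"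
    by (simp add: a_pow)
  have "(b [^] m) [^] p = (b [^] p) [^] m" "(c [^] n) [^] p = (c [^] p) [^] n"
    by (simp_all add: nat_pow_pow mult.commute)
  then have 2: "(b [^] m) [^] p = \<one>" "(c [^] n) [^] p = \<one>"
    by (simp_all add: b_pow c_pow)
  have 3: "nf i 0 y \<otimes> b [^] m = b [^] m \<otimes> nf i 0 y"
    by (simp add: nf_mult flip: nf_b)
  have "c [^] n \<otimes> nf i 0 y = nf i 0 (n * s ^ i + y)"
    by (simp add: nf_mult flip: nf_c)
  also have "\<dots> = nf i 0 (y + n * s)"
    using cong_add[OF cong_mult[OF cong_refl s_pow_one[OF i]] cong_refl, of n y]
    by (intro nf_cong) (simp_all add: add.commute)
  also have "\<dots> = nf i 0 y \<otimes> (c [^] n) [^] s"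
    by (simp add: nf_mult nat_pow_pow nf_c[symmetric, of "n * s"])
  finally show ?thesis
    using 1 2 3 commute_pow[OF bc] by (simp add: satisfies_relations_def)
qed

text \<open>Restriction to the carrier makes the function extensional, as membership in the automorphism
  group requires, and hence determined by its values on the generators.\<close>

definition endo :: "nat \<Rightarrow> nat \<Rightarrow> nat \<Rightarrow> nat \<Rightarrow> 'a \<Rightarrow> 'a" where
  "endo i y m n = restrict
     (SOME h. h \<in> hom G G \<and> h a = nf i 0 y \<and> h b = b [^] m \<and> h c = c [^] n) (carrier G)"

lemma endo:
  assumes i: "[i = 1] (mod q)"
  shows "endo i y m n \<in> hom G G" "endo i y m n a = nf i 0 y"
    "endo i y m n b = b [^] m" "endo i y m n c = c [^] n"
proof -
  let ?P = "\<lambda>h. h \<in> hom G G \<and> h a = nf i 0 y \<and> h b = b [^] m \<and> h c = c [^] n"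
  have "\<exists>h. ?P h"
    using endomorphism_ex[OF images_satisfy_relations[OF i]] by blast
  then have *: "?P (SOME h. ?P h)"
    by (rule someI_ex)
  then show "endo i y m n a = nf i 0 y" "endo i y m n b = b [^] m" "endo i y m n c = c [^] n"
    by (simp_all add: endo_def)
  show "endo i y m n \<in> hom G G"
    using * by (auto simp: endo_def hom_def)
qed

lemma endo_eqI:
  assumes i: "[i = 1] (mod q)" and h: "h \<in> hom G G" "h \<in> extensional (carrier G)"
    and abc: "h a = nf i 0 y" "h b = b [^] m" "h c = c [^] n"
  shows "h = endo i y m n"
proof
  fix x
  show "h x = endo i y m n x"
  proof (cases "x \<in> carrier G")
    case True
    then obtain i' j' k' where "x = nf i' j' k'"
      using nf_exhaust by blast
    then show ?thesis
      using hom_nf[OF is_group h(1)] hom_nf[OF is_group endo(1)[OF i]] endo[OF i] abc by simp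
  qed (use h(2) in \<open>simp add: endo_def extensional_def\<close>)
qed

lemma endo_cong:
  assumes i: "[i = 1] (mod q)"
    and "[i = i'] (mod q ^ 2)" "[y = y'] (mod p)" "[m = m'] (mod p)" "[n = n'] (mod p)"
  shows "endo i y m n = endo i' y' m' n'"
proof -
  have "nf i 0 y = nf i' 0 y'" "b [^] m = b [^] m'" "c [^] n = c [^] n'"
    using assms by (simp_all add: nf_eq_iff flip: nf_b nf_c)
  then show ?thesis
    by (simp add: endo_def)
qed

text \<open>The multiplication of the semidirect product appears in the image of \<open>a\<close>:
  \<open>(a\<^sup>i c\<^sup>y)\<^bsup>i'\<^esup> c\<^bsup>n y'\<^esup>\<close> collapses by \<open>twisted_pow\<close>.\<close>

lemma endo_compose:
  assumes i: "[i = 1] (mod q)" and i': "[i' = 1] (mod q)"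
  shows "compose (carrier G) (endo i y m n) (endo i' y' m' n') =
    endo (i * i') (y + n * y') (m * m') (n * n')"
proof (rule endo_eqI)
  show "[i * i' = 1] (mod q)"
    using cong_mult[OF i i'] by simp
  show "compose (carrier G) (endo i y m n) (endo i' y' m' n') \<in> hom G G"
    using endo(1)[OF i'] endo(1)[OF i] by (rule hom_compose)
  show "compose (carrier G) (endo i y m n) (endo i' y' m' n') \<in> extensional (carrier G)"
    by (simp add: compose_def)
  note h = hom_nf[OF is_group endo(1)[OF i, of y m n], unfolded endo[OF i]]
  have "endo i y m n (nf i' 0 y') = nf i 0 y [^] i' \<otimes> c [^] (n * y')"
    by (simp add: h nat_pow_pow)
  also have "\<dots> = nf (i * i') 0 (y + n * y')"
    by (simp add: twisted_pow[OF i i'] nf_mult flip: nf_c)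
  finally show "compose (carrier G) (endo i y m n) (endo i' y' m' n') a = nf (i * i') 0 (y + n * y')"
    by (simp add: compose_def endo[OF i'])
  show "compose (carrier G) (endo i y m n) (endo i' y' m' n') b = b [^] (m * m')"
    using h[of 0 m' 0] by (simp add: compose_def endo[OF i'] nat_pow_pow nf_b)
  show "compose (carrier G) (endo i y m n) (endo i' y' m' n') c = c [^] (n * n')"
    using h[of 0 0 n'] by (simp add: compose_def endo[OF i'] nat_pow_pow nf_c)
qed

lemma endo_id: "endo 1 0 1 1 = (\<lambda>x\<in>carrier G. x)"
  by (rule endo_eqI[symmetric]) (auto simp: hom_def nf_def)

lemma endo_eqD:
  assumes i: "[i = 1] (mod q)" and i': "[i' = 1] (mod q)"
    and "endo i y m n = endo i' y' m' n'"
  shows "[i = i'] (mod q ^ 2)" "[y = y'] (mod p)" "[m = m'] (mod p)" "[n = n'] (mod p)"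
proof -
  have "nf i 0 y = nf i' 0 y'" "nf 0 m 0 = nf 0 m' 0" "nf 0 0 n = nf 0 0 n'"
    using assms(3) endo[OF i] endo[OF i'] nf_b nf_c by metis+
  then show "[i = i'] (mod q ^ 2)" "[y = y'] (mod p)" "[m = m'] (mod p)" "[n = n'] (mod p)"
    by (simp_all add: nf_eq_iff)
qed

text \<open>Write the three images in normal form. The orders of \<open>b\<close> and \<open>c\<close> remove \<open>a\<close> from their images, and
  \<open>c a = a c\<^sup>s\<close> removes \<open>b\<close> from the image of \<open>c\<close> and then forces \<open>s\<^sup>i = s\<close>. Next, \<open>a b = b a\<close> removes
  \<open>c\<close> from the image of \<open>b\<close>, and the order of \<open>a\<close> removes \<open>b\<close> from the image of \<open>a\<close>.\<close>

lemma auto_is_endo: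
  assumes f: "f \<in> auto G"
  obtains i y m n where "f = endo i y m n" "[i = 1] (mod q)" "\<not> p dvd m" "\<not> p dvd n"
proof -
  have hom: "f \<in> hom G G" and inj: "inj_on f (carrier G)" and ext: "f \<in> extensional (carrier G)"
    using f by (auto simp: auto_def Bij_def bij_betw_def)
  interpret f: group_hom G G f
    by unfold_locales (rule hom)
  obtain i x y where a: "f a = nf i x y" using nf_exhaust[of "f a"] by auto
  obtain i2 j2 k2 where b0: "f b = nf i2 j2 k2" using nf_exhaust[of "f b"] by auto
  obtain i3 j3 k3 where c0: "f c = nf i3 j3 k3" using nf_exhaust[of "f c"] by auto
  have cop: "coprime (q ^ 2) p"
    using prime_p prime_q p_neq_q primes_coprime by (metis coprime_power_left_iff)
  have order_p: "q ^ 2 dvd i'" if "nf i' j' k' [^] p = \<one>" for i' j' k'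
  proof -
    obtain k'' where "nf i' j' k' [^] p = nf (p * i') (p * j') k''"
      using nf_pow_ex by blast
    then have "q ^ 2 dvd p * i'"
      using that nf_eq_one by metis
    then show ?thesis
      using cop by (simp add: coprime_dvd_mult_right_iff)
  qed
  have "f b [^] p = \<one>" "f c [^] p = \<one>"
    using b_pow c_pow by (metis f.hom_nat_pow f.hom_one gen_closed)+
  then have "q ^ 2 dvd i2" "q ^ 2 dvd i3"
    using order_p b0 c0 by auto
  then have b: "f b = nf 0 j2 k2" and c1: "f c = nf 0 j3 k3"
    unfolding b0 c0 by (auto simp: nf_eq_iff cong_0_iff)
  have "f c \<otimes> f a = f a \<otimes> f c [^] s"
    using ca by (metis f.hom_mult f.hom_nat_pow gen_closed nat_pow_closed)
  moreover obtain k' where "f c [^] s = nf 0 (s * j3) k'"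
    using nf_pow_ex[of 0 j3 k3 s] c1 by auto
  ultimately have "[j3 + x = x + s * j3] (mod p)"
    by (simp add: a c1 nf_mult nf_eq_iff)
  then have "[s * j3 = j3] (mod p)"
    by (metis add.commute cong_add_lcancel_nat cong_sym)
  then have "p dvd j3"
    by (rule s_minus_one_cancel)
  then have c: "f c = nf 0 0 k3"
    unfolding c1 by (auto simp: nf_eq_iff cong_0_iff)
  have nontrivial: "f u \<noteq> \<one>" if "u \<in> carrier G" "u \<noteq> \<one>" for u
    using that inj by (metis f.hom_one inj_onD one_closed)
  have "\<not> p dvd 1"
    using prime_p by (simp add: prime_nat_iff)
  then have "b \<noteq> \<one>" "c \<noteq> \<one>"
    using nf_eq_one[of 0 1 0] nf_eq_one[of 0 0 1] by (auto simp: nf_def)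
  then have fbc: "f b \<noteq> \<one>" "f c \<noteq> \<one>"
    using nontrivial by auto
  have k3: "\<not> p dvd k3"
    using fbc(2) nf_cong[of 0 0 0 0 k3 0] by (auto simp: c cong_0_iff)
  have "nf 0 0 k3 [^] s = nf 0 0 (k3 * s)"
    by (simp add: nf_c nat_pow_pow)
  then have "[k3 * s ^ i + y = y + k3 * s] (mod p)"
    using \<open>f c \<otimes> f a = f a \<otimes> f c [^] s\<close> by (simp add: a c nf_mult nf_eq_iff)
  then have "[k3 * s ^ i = k3 * s] (mod p)"
    by (metis add.commute cong_add_lcancel_nat)
  moreover have "coprime k3 p"
    using k3 prime_p by (metis coprime_commute prime_imp_coprime)
  ultimately have si: "[s ^ i = s] (mod p)"
    by (simp add: cong_mult_lcancel_nat)
  then have i: "[i = 1] (mod q)"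
    by (simp add: s_pow_cong)
  have "f a \<otimes> f b = f b \<otimes> f a"
    using ab by (metis f.hom_mult gen_closed)
  then have "[y + k2 = k2 * s ^ i + y] (mod p)"
    by (simp add: a b nf_mult nf_eq_iff)
  then have "[k2 * s ^ i = k2] (mod p)"
    by (metis add.commute cong_add_lcancel_nat cong_sym)
  then have "[s * k2 = k2] (mod p)"
    using cong_mult[OF cong_refl[of k2] si] by (metis cong_sym cong_trans mult.commute)
  then have "p dvd k2"
    by (rule s_minus_one_cancel)
  then have b': "f b = nf 0 j2 0"
    unfolding b by (auto simp: nf_eq_iff cong_0_iff)
  then have j2: "\<not> p dvd j2"
    using fbc(1) nf_cong[of 0 0 j2 0 0 0] by (auto simp: cong_0_iff)
  have "f a [^] (q ^ 2) = \<one>"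
    using a_pow by (metis f.hom_nat_pow f.hom_one gen_closed(1))
  moreover obtain k' where "f a [^] (q ^ 2) = nf (q ^ 2 * i) (q ^ 2 * x) k'"
    using nf_pow_ex a by metis
  ultimately have "p dvd q ^ 2 * x"
    using nf_eq_one by metis
  then have "p dvd x"
    using cop by (simp add: coprime_commute coprime_dvd_mult_right_iff)
  then have a': "f a = nf i 0 y"
    unfolding a by (auto simp: nf_eq_iff cong_0_iff)
  have "f = endo i y j2 k3"
    using i hom ext a' b' c by (intro endo_eqI) (simp_all add: nf_b nf_c)
  then show thesis
    using that i j2 k3 by blast
qed


lemma auto_group_iso_semidirect_product:
  fixes g :: nat
  assumes g: "residue_primroot p g"
  defines "\<phi> \<equiv> power_action p g \<circ> (fst \<circ> fst)"
  defines "S \<equiv> semidirect_product (integer_mod_group p)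
    ((integer_mod_group (p - 1) \<times>\<times> integer_mod_group (p - 1)) \<times>\<times> integer_mod_group q) \<phi>"
  shows "\<phi> \<in> hom ((integer_mod_group (p - 1) \<times>\<times> integer_mod_group (p - 1)) \<times>\<times> integer_mod_group q)
      (AutoGroup (integer_mod_group p))"
    and "AutoGroup G \<cong> S"
proof -
  let ?Y = "(integer_mod_group (p - 1) \<times>\<times> integer_mod_group (p - 1)) \<times>\<times> integer_mod_group q"
  have p1: "p > 1"
    using prime_p by (rule prime_gt_1_nat)
  have g_cop: "coprime p g" and g_ord: "Pocklington.ord p g = p - 1"
    using g prime_p by (auto simp: residue_primroot_def totient_prime)
  have g_pow: "[g ^ i = g ^ j] (mod p) \<longleftrightarrow> [i = j] (mod (p - 1))" for i j
    using order_divides_expdiff[OF g_cop] g_ord by simp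
  have g_surj: "\<exists>u<p - 1. [g ^ u = m] (mod p)" if "\<not> p dvd m" for m
  proof -
    have "m mod p \<in> totatives p"
      using that p1 prime_p by (simp add: totatives_prime) (meson mod_greater_zero_iff_not_dvd)
    then have "m mod p \<in> (\<lambda>i. g ^ i mod p) ` {..<p - 1}"
      using residue_primroot_is_generator[OF p1 g] prime_p
      by (simp add: bij_betw_def totient_prime)
    then show ?thesis
      by (auto simp: cong_def)
  qed
  show hom_\<phi>: "\<phi> \<in> hom ?Y (AutoGroup (integer_mod_group p))"
  proof -
    have "fst \<circ> fst \<in> hom ?Y (integer_mod_group (p - 1))"
      by (auto simp: hom_def)
    moreover have "power_action p g \<in> hom (integer_mod_group (p - 1)) (AutoGroup (integer_mod_group p))"
      using p1 g_pow[of "p - 1" 0] by (intro power_action_hom) (auto simp: cong_0_iff)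
    ultimately show ?thesis
      unfolding \<phi>_def by (rule Group.hom_compose)
  qed
  have group_S: "group S"
    unfolding S_def by (intro group_semidirect_product hom_\<phi> DirProd_group group_integer_mod_group)
  have carrier_S: "carrier S = {0..<int p} \<times> (({0..<int (p - 1)} \<times> {0..<int (p - 1)}) \<times> {0..<int q})"
    using p1 q_pos by (simp add: S_def semidirect_product_def carrier_integer_mod_group)
  \<comment> \<open>The exponent of \<open>c\<close>, which acts on \<open>y\<close>, comes from the first coordinate \<open>u\<close>, in agreement with \<open>\<phi>\<close>.\<close>
  define \<Psi> where "\<Psi> = (\<lambda>(y, (u, v), w). endo (1 + q * nat w) (nat y) (g ^ nat v) (g ^ nat u))"
  have one_mod: "[1 + q * w = 1] (mod q)" for w :: nat
    unfolding cong_def by (rule mod_mult_self2)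
  have q_cong: "[1 + q * w = 1 + q * w'] (mod q ^ 2) \<longleftrightarrow> [w = w'] (mod q)" for w w'
  proof -
    have "[q * w = q * w'] (mod q ^ 2) \<longleftrightarrow> [w = w'] (mod q)"
      using q_pos by (simp only: cong_def power2_eq_square mult_mod_right[symmetric]) simp
    then show ?thesis
      by (simp only: cong_add_lcancel_nat)
  qed
  have nat_add_cong: "[nat ((x + x') mod int n) = nat x + nat x'] (mod n)"
    if "x \<ge> 0" "x' \<ge> 0" for x x' n
    using that by (simp add: cong_def nat_mod_distrib nat_add_distrib)
  have \<Psi>_mult: "\<Psi> (x \<otimes>\<^bsub>S\<^esub> x') = compose (carrier G) (\<Psi> x) (\<Psi> x')"
    if "x \<in> carrier S" "x' \<in> carrier S" for x x'
  proof -
    obtain y u v w where x: "x = (y, (u, v), w)" by (metis surj_pair)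
    obtain y' u' v' w' where x': "x' = (y', (u', v'), w')" by (metis surj_pair)
    have nonneg: "y \<ge> 0" "u \<ge> 0" "v \<ge> 0" "w \<ge> 0" "y' \<ge> 0" "u' \<ge> 0" "v' \<ge> 0" "w' \<ge> 0"
      and y': "y' \<in> carrier (integer_mod_group p)"
      using that p1 by (auto simp: x x' carrier_S carrier_integer_mod_group)
    have "\<Psi> (x \<otimes>\<^bsub>S\<^esub> x') =
        endo (1 + q * nat ((w + w') mod int q)) (nat ((y + int (g ^ nat u) * y' mod int p) mod int p))
          (g ^ nat ((v + v') mod int (p - 1))) (g ^ nat ((u + u') mod int (p - 1)))"
      using y' by (simp add: \<Psi>_def S_def semidirect_product_def x x' \<phi>_def power_action_def)
    also have "\<dots> = endo ((1 + q * nat w) * (1 + q * nat w')) (nat y + g ^ nat u * nat y')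
        (g ^ nat v * g ^ nat v') (g ^ nat u * g ^ nat u')"
    proof (rule endo_cong)
      have "[1 + q * nat ((w + w') mod int q) = 1 + q * (nat w + nat w')] (mod q ^ 2)"
        unfolding q_cong using nonneg by (simp add: nat_add_cong)
      also have "[1 + q * (nat w + nat w') = 1 + q * (nat w + nat w') + q ^ 2 * (nat w * nat w')] (mod q ^ 2)"
        by (simp add: cong_def)
      also have "1 + q * (nat w + nat w') + q ^ 2 * (nat w * nat w') = (1 + q * nat w) * (1 + q * nat w')"
        by (simp add: algebra_simps power2_eq_square)
      finally show "[1 + q * nat ((w + w') mod int q) = (1 + q * nat w) * (1 + q * nat w')] (mod q ^ 2)" .
      have "[int (nat ((y + int (g ^ nat u) * y' mod int p) mod int p)) =
          int (nat y + g ^ nat u * nat y')] (mod int p)"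
        using nonneg p1 by (simp add: cong_def mod_simps)
      then show "[nat ((y + int (g ^ nat u) * y' mod int p) mod int p) = nat y + g ^ nat u * nat y'] (mod p)"
        unfolding cong_int_iff .
    qed (use nonneg one_mod[of "nat ((w + w') mod int q)"] in \<open>simp_all add: g_pow nat_add_cong flip: power_add\<close>)
    finally show ?thesis
      unfolding \<Psi>_def x x' prod.case endo_compose[OF one_mod one_mod] .
  qed
  have \<Psi>_one: "\<Psi> \<one>\<^bsub>S\<^esub> = (\<lambda>x\<in>carrier G. x)"
    using endo_id by (simp add: \<Psi>_def S_def semidirect_product_def)
  have \<Psi>_hom: "\<Psi> x \<in> hom G G" for x
  proof -
    obtain y u v w where x: "x = (y, (u, v), w)" by (metis surj_pair)
    show ?thesis
      unfolding x \<Psi>_def prod.case by (rule endo(1)[OF one_mod])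
  qed
  \<comment> \<open>\<open>\<Psi>\<close> turns products into compositions, so the image of the inverse of \<open>x\<close> inverts \<open>\<Psi> x\<close>;
    bijectivity needs no computation with exponents.\<close>
  have \<Psi>_auto: "\<Psi> x \<in> auto G" if x: "x \<in> carrier S" for x
  proof -
    let ?x' = "inv\<^bsub>S\<^esub> x"
    have x': "?x' \<in> carrier S"
      using group_S x by (simp add: group.inv_closed)
    have "compose (carrier G) (\<Psi> x) (\<Psi> ?x') = (\<lambda>x\<in>carrier G. x)"
      "compose (carrier G) (\<Psi> ?x') (\<Psi> x) = (\<lambda>x\<in>carrier G. x)"
      using group_S x x' by (simp_all add: \<Psi>_one group.r_inv group.l_inv flip: \<Psi>_mult)
    then have "\<Psi> x (\<Psi> ?x' z) = z" "\<Psi> ?x' (\<Psi> x z) = z" if "z \<in> carrier G" for z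
      using that by (metis compose_eq restrict_apply')+
    moreover have "\<Psi> x ` carrier G \<subseteq> carrier G" "\<Psi> ?x' ` carrier G \<subseteq> carrier G"
      by (rule hom_carrier[OF \<Psi>_hom])+
    ultimately have "bij_betw (\<Psi> x) (carrier G) (carrier G)"
      by (intro bij_betw_byWitness[of _ "\<Psi> ?x'"]) auto
    moreover have "\<Psi> x \<in> extensional (carrier G)"
      by (cases x) (auto simp: \<Psi>_def endo_def split: prod.splits)
    ultimately show ?thesis
      using \<Psi>_hom by (simp add: auto_def Bij_def)
  qed
  have "\<Psi> \<in> hom S (AutoGroup G)"
  proof (rule homI)
    show "\<Psi> x \<in> carrier (AutoGroup G)" if "x \<in> carrier S" for x
      using \<Psi>_auto[OF that] by (simp add: AutoGroup_def)
    show "\<Psi> (x \<otimes>\<^bsub>S\<^esub> x') = \<Psi> x \<otimes>\<^bsub>AutoGroup G\<^esub> \<Psi> x'" if "x \<in> carrier S" "x' \<in> carrier S" for x x'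
      using \<Psi>_auto[OF that(1)] \<Psi>_auto[OF that(2)] \<Psi>_mult[OF that]
      by (simp add: AutoGroup_def BijGroup_def auto_def)
  qed
  moreover have "inj_on \<Psi> (carrier S)"
  proof (rule inj_onI)
    fix x x' assume mem: "x \<in> carrier S" "x' \<in> carrier S" and eq: "\<Psi> x = \<Psi> x'"
    obtain y u v w where x: "x = (y, (u, v), w)" by (metis surj_pair)
    obtain y' u' v' w' where x': "x' = (y', (u', v'), w')" by (metis surj_pair)
    note D = endo_eqD[OF one_mod one_mod eq[unfolded \<Psi>_def x x' prod.case], unfolded q_cong g_pow]
    have *: "z = z'" if "[nat z = nat z'] (mod n)" "z \<in> {0..<int n}" "z' \<in> {0..<int n}" for z z' n
      using that by (auto simp: cong_def nat_less_iff)
    show "x = x'"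
      using mem D *[of y y' p] *[of u u' "p - 1"] *[of v v' "p - 1"] *[of w w' q]
      by (simp add: x x' carrier_S)
  qed
  moreover have "\<Psi> ` carrier S = carrier (AutoGroup G)"
  proof
    show "\<Psi> ` carrier S \<subseteq> carrier (AutoGroup G)"
      using \<Psi>_auto by (auto simp: AutoGroup_def)
    show "carrier (AutoGroup G) \<subseteq> \<Psi> ` carrier S"
    proof
      fix f assume "f \<in> carrier (AutoGroup G)"
      then have "f \<in> auto G"
        by (simp add: AutoGroup_def)
      then obtain i y m n where f: "f = endo i y m n" and i: "[i = 1] (mod q)"
        and mn: "\<not> p dvd m" "\<not> p dvd n"
        by (rule auto_is_endo)
      obtain v u where v: "v < p - 1" "[g ^ v = m] (mod p)" and u: "u < p - 1" "[g ^ u = n] (mod p)"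
        using g_surj[OF mn(1)] g_surj[OF mn(2)] by auto
      have "i mod q = 1"
        using i prime_gt_1_nat[OF prime_q] by (simp add: cong_def)
      then have i_eq: "i = 1 + q * (i div q)"
        by (metis add.commute mult_div_mod_eq)
      have "[i = 1 + q * (i div q mod q)] (mod q ^ 2)"
        by (subst i_eq) (simp only: q_cong cong_mod_right cong_refl)
      then have "f = endo (1 + q * (i div q mod q)) (y mod p) (g ^ v) (g ^ u)"
        unfolding f using v u by (intro endo_cong[OF i]) (auto simp: cong_sym)
      then have "f = \<Psi> (int (y mod p), (int u, int v), int (i div q mod q))"
        by (simp add: \<Psi>_def)
      moreover have "(int (y mod p), (int u, int v), int (i div q mod q)) \<in> carrier S"
        using u v p1 q_pos by (auto simp: carrier_S simp flip: of_nat_mod)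
      ultimately show "f \<in> \<Psi> ` carrier S"
        by blast
    qed
  qed
  ultimately have "S \<cong> AutoGroup G"
    unfolding is_iso_def iso_def bij_betw_def by blast
  then show "AutoGroup G \<cong> S"
    by (rule group.iso_sym[OF group_S])
qed

end

section \<open>The presented group\<close>

definition pqr_gen :: "nat \<Rightarrow> nat \<Rightarrow> int \<Rightarrow> gen \<Rightarrow> gen word set set" where
  "pqr_gen p q r x = normal_closure free_group (relators p q r) #>\<^bsub>free_group\<^esub> free_gen x"

lemma group_pqr_universal:
  assumes "group H" and rel: "satisfies_relations H p q s a b c" and s: "[int s = r] (mod int p)"
  obtains h where "h \<in> hom (group_pqr p q r) H"
    "h (pqr_gen p q r gen_a) = a"
    "h (pqr_gen p q r gen_b) = b"
    "h (pqr_gen p q r gen_c) = c"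
proof -
  interpret H: group H by fact
  have "range (case_gen a b c) \<subseteq> carrier H"
    using rel by (auto simp: satisfies_relations_def split: gen.splits)
  then obtain f where f: "f \<in> hom free_group H" "\<And>x. f (free_gen x) = case_gen a b c x"
    using H.free_group_universal by blast
  then have "\<forall>x\<in>relators p q r. f x = \<one>\<^bsub>H\<^esub>"
    using H.relators_trivial_iff[OF f(1) s] rel by simp
  then obtain h where "h \<in> hom (group_pqr p q r) H"
    "\<And>x. x \<in> carrier free_group \<Longrightarrow>
      h (normal_closure free_group (relators p q r) #>\<^bsub>free_group\<^esub> x) = f x"
    using H.presented_group_universal[OF relators_closed f(1)] unfolding group_pqr_def by blast
  then show thesis
    using that by (simp add: pqr_gen_def free_gen_closed f(2))
qed

text \<open>Uniqueness of normal forms is detected in quotients: \<open>\<int>\<close> modulo \<open>q\<^sup>2\<close> sees the exponent of \<open>a\<close>,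
  \<open>\<int>\<close> modulo \<open>p\<close> that of \<open>b\<close>, and a semidirect product of the two cyclic groups that of \<open>c\<close>.\<close>

lemma group_pqr_pqr_group:
  assumes prime: "prime p" "prime q" "p \<noteq> q" and s: "[int s = r] (mod int p)"
    and s_pow: "[s ^ q = 1] (mod p)" and s_neq: "\<not> [s = 1] (mod p)"
  shows "pqr_group (group_pqr p q r) p q s (pqr_gen p q r gen_a) (pqr_gen p q r gen_b) (pqr_gen p q r gen_c)"
proof -
  let ?P = "group_pqr p q r" and ?\<pi> = "pqr_gen p q r"
  let ?N = "normal_closure free_group (relators p q r)"
  interpret F: group "free_group :: gen word set monoid" by (rule group_free_group)
  interpret N: normal ?N free_group
    by (rule F.normal_normal_closure[OF relators_closed])
  interpret P: group ?P by (rule group_group_pqr)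
  have proj: "(\<lambda>x. ?N #>\<^bsub>free_group\<^esub> x) \<in> hom free_group ?P"
    unfolding group_pqr_def presented_group_def by (rule N.r_coset_hom_Mod)
  have "?N #>\<^bsub>free_group\<^esub> x = \<one>\<^bsub>?P\<^esub>" if "x \<in> relators p q r" for x
  proof -
    have "x \<in> ?N"
      using that by (auto simp: normal_closure_def)
    then show ?thesis
      by (simp add: group_pqr_def presented_group_def N.rcos_const F.is_group)
  qed
  then have rel: "satisfies_relations ?P p q s (?\<pi> gen_a) (?\<pi> gen_b) (?\<pi> gen_c)"
    unfolding pqr_gen_def by (intro iffD1[OF P.relators_trivial_iff[OF proj s]] ballI)
  have pos: "p > 0" "q > 0"
    using prime prime_gt_0_nat by auto
  interpret relations_group ?P p q s "?\<pi> gen_a" "?\<pi> gen_b" "?\<pi> gen_c"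
    using rel pos by unfold_locales
  note universal = group_pqr_universal[OF _ _ s]
  show ?thesis
  proof unfold_locales
    fix x assume "x \<in> carrier ?P"
    then obtain z where "z \<in> carrier free_group" "x = ?N #>\<^bsub>free_group\<^esub> z"
      by (auto simp: group_pqr_def presented_group_def carrier_FactGroup)
    then show "\<exists>i j k. x = nf i j k"
      using generated_eq_nf[OF proj] by (simp add: pqr_gen_def)
  next
    fix a' b' c' assume "satisfies_relations ?P p q s a' b' c'"
    then show "\<exists>h\<in>hom ?P ?P. h (?\<pi> gen_a) = a' \<and> h (?\<pi> gen_b) = b' \<and> h (?\<pi> gen_c) = c'"
      using universal[OF P.is_group] by metis
  next
    fix i j k assume one: "nf i j k = \<one>\<^bsub>?P\<^esub>"
    have image: "a' [^]\<^bsub>H\<^esub> i \<otimes>\<^bsub>H\<^esub> b' [^]\<^bsub>H\<^esub> j \<otimes>\<^bsub>H\<^esub> c' [^]\<^bsub>H\<^esub> k = \<one>\<^bsub>H\<^esub>"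
      if H: "group H" and rel': "satisfies_relations H p q s a' b' c'" for H :: "'b monoid" and a' b' c'
    proof -
      obtain h where h: "h \<in> hom ?P H" "h (?\<pi> gen_a) = a'" "h (?\<pi> gen_b) = b'" "h (?\<pi> gen_c) = c'"
        using universal[OF H rel'] by blast
      show ?thesis
        using hom_nf[OF H h(1), of i j k] h(2-4) one hom_one[OF h(1) P.is_group H] by simp
    qed
    have carrier: "carrier (integer_mod_group m) = {0..<int m}" if "m > 0" for m
      using that by (simp add: carrier_integer_mod_group)
    have gt_1: "p > 1" "q ^ 2 > 1" "(int q) ^ 2 > 1"
      using prime(1,2)[THEN prime_gt_1_nat] one_less_power[of q 2] one_less_power[of "int q" 2]
      by simp_all
    have "int i mod int (q ^ 2) = 0"
    proof -
      have "satisfies_relations (integer_mod_group (q ^ 2)) p q s 1 0 0"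
        using gt_1 pos by (simp add: satisfies_relations_def carrier)
      from image[OF group_integer_mod_group this] show ?thesis
        by simp
    qed
    then have i: "q ^ 2 dvd i"
      by presburger
    have "int j mod int p = 0"
    proof -
      have "satisfies_relations (integer_mod_group p) p q s 0 1 0"
        using gt_1 pos by (simp add: satisfies_relations_def carrier)
      from image[OF group_integer_mod_group this] show ?thesis
        by simp
    qed
    then have j: "p dvd j"
      by presburger
    have "int k mod int p = 0"
    proof -
      \<comment> \<open>In the semidirect product \<open>y\<close> acts by \<open>x \<mapsto> y x y\<^sup>-\<^sup>1\<close>, whereas the relation prescribes
        \<open>a\<^sup>-\<^sup>1 c a\<close>; hence the inverse \<open>t\<close> of \<open>s\<close> modulo \<open>p\<close>.\<close>
      define t where "t = s ^ (q - 1)"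
      have ts: "[t * s = 1] (mod p)"
        using s_pow pos by (simp add: t_def flip: power_Suc2)
      have "[(s ^ q) ^ (q * (q - 1)) = 1 ^ (q * (q - 1))] (mod p)"
        by (rule cong_pow[OF s_pow])
      then have t_pow: "[t ^ (q ^ 2) = 1] (mod p)"
        by (simp add: t_def power2_eq_square mult_ac flip: power_mult)
      let ?H = "semidirect_product (integer_mod_group p) (integer_mod_group (q ^ 2)) (power_action p t)"
      have "group ?H"
        by (intro group_semidirect_product group_integer_mod_group power_action_hom t_pow) (use pos in auto)
      interpret H: group ?H by fact
      have a_pow: "(0, 1) [^]\<^bsub>?H\<^esub> m = (0, int m mod int (q ^ 2))" for m
        using pos gt_1 by (induction m) (auto simp: semidirect_product_def power_action_def carrier mod_simps add.commute)
      have c_pow: "(1, 0) [^]\<^bsub>?H\<^esub> m = (int m mod int p, 0)" for m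
        using pos gt_1 by (induction m) (auto simp: semidirect_product_def power_action_def carrier mod_simps add.commute)
      have "int t * int s mod int p = 1"
        using ts gt_1 by (simp add: cong_def flip: of_nat_mult of_nat_mod)
      then have "(1, 0) \<otimes>\<^bsub>?H\<^esub> (0, 1) = (0, 1) \<otimes>\<^bsub>?H\<^esub> (int s mod int p, 0)"
        using gt_1 pos by (simp add: semidirect_product_def power_action_def carrier mod_simps)
      moreover have "(0, 0) [^]\<^bsub>?H\<^esub> p = \<one>\<^bsub>?H\<^esub>"
        using H.nat_pow_one[of p] by (simp add: semidirect_product_def)
      moreover have "(0, 1) \<otimes>\<^bsub>?H\<^esub> (0, 0) = (0, 0) \<otimes>\<^bsub>?H\<^esub> (0, 1)"
        "(0, 0) \<otimes>\<^bsub>?H\<^esub> (1, 0) = (1, 0) \<otimes>\<^bsub>?H\<^esub> (0, 0)"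
        using gt_1 pos by (simp_all add: semidirect_product_def power_action_def carrier)
      moreover have "(0, 1) \<in> carrier ?H" "(0, 0) \<in> carrier ?H" "(1, 0) \<in> carrier ?H"
        using gt_1 pos by (simp_all add: semidirect_product_def carrier)
      moreover have "(0, 0) = \<one>\<^bsub>?H\<^esub>"
        by (simp add: semidirect_product_def)
      ultimately have "satisfies_relations ?H p q s (0, 1) (0, 0) (1, 0)"
        unfolding satisfies_relations_def a_pow c_pow by simp
      from image[OF \<open>group ?H\<close> this] have "(0, int i mod int (q ^ 2)) \<otimes>\<^bsub>?H\<^esub> \<one>\<^bsub>?H\<^esub> [^]\<^bsub>?H\<^esub> j \<otimes>\<^bsub>?H\<^esub> (int k mod int p, 0) = \<one>\<^bsub>?H\<^esub>"
        unfolding a_pow c_pow by (simp add: semidirect_product_def)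
      moreover have "(0, int i mod int (q ^ 2)) = \<one>\<^bsub>?H\<^esub>"
        using \<open>int i mod int (q ^ 2) = 0\<close> by (simp add: semidirect_product_def)
      moreover have "(int k mod int p, 0) \<in> carrier ?H"
        using pos by (simp add: semidirect_product_def carrier)
      ultimately have "(int k mod int p, 0) = \<one>\<^bsub>?H\<^esub>"
        by (simp only: H.nat_pow_one H.l_one H.one_closed)
      then show ?thesis
        by (simp add: semidirect_product_def)
    qed
    then have "p dvd k"
      by presburger
    then show "q ^ 2 dvd i \<and> p dvd j \<and> p dvd k"
      using i j by blast
  qed (use prime s_pow s_neq in auto)
qed

theorem mainTheorem7:
  fixes p q :: nat and r :: int
  assumes "prime p" and "prime q" and "p \<noteq> q" and "p * q \<noteq> 6" and "q \<noteq> 2"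
    and "q dvd p - 1"
    and "[r ^ q = 1] (mod int p)" and "\<not> [r = 1] (mod int p)"
  shows "\<exists>\<phi> \<in> hom ((integer_mod_group (p - 1) \<times>\<times> integer_mod_group (p - 1)) \<times>\<times> integer_mod_group q)
                  (AutoGroup (integer_mod_group p)).
           AutoGroup (group_pqr p q r) \<cong>
           semidirect_product (integer_mod_group p)
             ((integer_mod_group (p - 1) \<times>\<times> integer_mod_group (p - 1)) \<times>\<times> integer_mod_group q) \<phi>"
proof -
  have p: "p > 1"
    using assms(1) by (rule prime_gt_1_nat)
  define s where "s = nat (r mod int p)"
  have int_s: "int s = r mod int p"
    using p by (simp add: s_def)
  then have s: "[int s = r] (mod int p)"
    by simp
  have "[int (s ^ q) = int 1] (mod int p)"
    using cong_trans[OF cong_pow[OF s] assms(7)] by simp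
  then have s_pow: "[s ^ q = 1] (mod p)"
    unfolding cong_int_iff .
  have s_neq: "\<not> [s = 1] (mod p)"
    using assms(8) s cong_int_iff[of s 1 p] by (auto simp: int_s)
  obtain g where "residue_primroot p g"
    using prime_primitive_root_exists[of p] assms(1) p by auto
  with pqr_group.auto_group_iso_semidirect_product[OF group_pqr_pqr_group[OF assms(1-3) s s_pow s_neq]]
  show ?thesis
    by blast
qed

end
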